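(* Fix $k\in\mathbb{Z}^+\cup\{+\infty\}$ and let $A$ be a finite non-empty alphabet. Let $\omega\in A^{\mathbb N}$ be an aperiodic (i.e. not ultimately periodic) infinite word. Then the following are equivalent: (1) $\omega$ is a Sturmian word (a balanced binary word); (2) for every $n\ge 0$, \[\mathcal{P}^{(k)}_\omega(n)=q^{(k)}(n)=\begin{cases} n+1 & \text{if } 0\le n\le 2k-1,\\ 2k & \text{if } n\ge 2k.\end{cases}\]
   Context: For $u,x\in A^*$ with $x$ non-empty, $|u|_x$ denotes the number of (possibly overlapping) occurrences of $x$ as a factor of $u$. For $k\in\mathbb{Z}^+\cup\{+\infty\}$, two words $u,v\in A^*$ are $k$-Abelian equivalent, written $u\sim_k v$, if $|u|_x=|v|_x$ for every non-empty word $x$ with $|x|\le k$ (so $\sim_{+\infty}$ is equality and $\sim_1$ is usual Abelian equivalence). For $\omega=a_0a_1a_2\cdots\in A^{\mathbb N}$, $\mathcal F_\omega(n)$ is the set of factors $a_ia_{i+1}\cdots a_{i+n-1}$ ($i\ge0$) of length $n$, and the $k$-Abelian complexity is $\mathcal{P}^{(k)}_\omega(n)=\mathrm{Card}(\mathcal F_\omega(n)/\sim_k)$. An infinite word is ultimately periodic if there is $p\ge1$ with $a_{i+p}=a_i$ for all sufficiently large $i$; aperiodic means not ultimately periodic. A Sturmian word is an infinite word over a two-letter alphabet having exactly $n+1$ factors of length $n$ for each $n\ge0$ (equivalently, an aperiodic balanced binary word). When $k=+\infty$, $q^{(k)}(n)=n+1$ for all $n$. *)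

theory Defs
  imports Main "HOL-Library.Extended_Nat" "HOL-Library.Omega_Words_Fun"
begin

definition occurrences :: "'a list \<Rightarrow> 'a list \<Rightarrow> nat" where
  "occurrences u x = card {i. i + length x \<le> length u \<and> take (length x) (drop i u) = x}"

definition k_abelian_equiv :: "'a set \<Rightarrow> enat \<Rightarrow> ('a list \<times> 'a list) set" where
  "k_abelian_equiv A k =
     {(u, v). u \<in> lists A \<and> v \<in> lists A \<and>
        (\<forall>x \<in> lists A. x \<noteq> [] \<and> enat (length x) \<le> k \<longrightarrow> occurrences u x = occurrences v x)}"

definition factors :: "'a word \<Rightarrow> nat \<Rightarrow> 'a list set" where
  "factors w n = range (\<lambda>i. w [i \<rightarrow> i + n])"

definition k_abelian_complexity :: "'a set \<Rightarrow> enat \<Rightarrow> 'a word \<Rightarrow> nat \<Rightarrow> nat" where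
  "k_abelian_complexity A k w n = card (factors w n // Restr (k_abelian_equiv A k) (factors w n))"

definition ultimately_periodic :: "'a word \<Rightarrow> bool" where
  "ultimately_periodic w \<longleftrightarrow> (\<exists>p\<ge>1. \<exists>N. \<forall>i\<ge>N. w (i + p) = w i)"

abbreviation aperiodic :: "'a word \<Rightarrow> bool" where
  "aperiodic w \<equiv> \<not> ultimately_periodic w"

text \<open>The two-letter alphabet of a Sturmian word is taken to be the set of letters that occur
  in it, so a Sturmian word may be regarded as a word over a larger ambient alphabet.\<close>

definition sturmian :: "'a word \<Rightarrow> bool" where
  "sturmian w \<longleftrightarrow> card (range w) = 2 \<and> (\<forall>n. card (factors w n) = n + 1)"

text \<open>Only used for positive \<open>k\<close>, so the subtraction below does not truncate.\<close>

definition sturmian_complexity :: "enat \<Rightarrow> nat \<Rightarrow> nat" where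
  "sturmian_complexity k n =
     (case k of
        enat m \<Rightarrow> if n \<le> 2 * m - 1 then n + 1 else 2 * m
      | \<infinity> \<Rightarrow> n + 1)"

end

theory Submission imports Defs begin

text \<open>
  Let \<open>N t\<close> denote the number of letters \<open>b\<close> among the first \<open>t\<close> letters of a binary word.
  In a balanced word, the factors of length \<open>n\<close> are totally ordered by componentwise comparison
  of \<open>N\<close>, and each \<open>N t\<close> takes at most two values.  So they form a chain of subsets of
  \<open>{1..n}\<close>, which is maximal when there are \<open>n + 1\<close> factors.  \<open>k\<close>-Abelian equivalence fixes
  \<open>N t\<close> for the positions \<open>t\<close> at distance less than \<open>k\<close> from either end, and in balanced words a
  telescoping sum shows that it amounts to exactly this.  Restricting a maximal chain to a set of
  \<open>r\<close> positions leaves \<open>r + 1\<close> sets, which is the claimed complexity.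

  If an aperiodic binary word is not balanced, take a minimal length \<open>m\<close> at which balance fails.
  It fails through a single pair \<open>a B a\<close>, \<open>b B b\<close> with \<open>B\<close> a palindrome, and aperiodicity forces
  at least \<open>m + 2\<close> factors of length \<open>m\<close>.  Without \<open>a B a\<close> these still form a maximal chain, and
  \<open>a B a\<close> has fewer letters \<open>b\<close> than all the others, so there is one class too many.
\<close>

section \<open>Chains of sets\<close>

lemma card_image_eq_if_same_kernel:
  assumes "\<And>u v. u \<in> U \<Longrightarrow> v \<in> U \<Longrightarrow> f u = f v \<longleftrightarrow> g u = g v"
  shows "card (f ` U) = card (g ` U)"
proof -
  have "bij_betw (\<lambda>y. g (inv_into U f y)) (f ` U) (g ` U)"
  proof (rule bij_betw_imageI)
    have key: "g (inv_into U f (f u)) = g u" if "u \<in> U" for u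
      using assms[of "inv_into U f (f u)" u] that
      by (meson f_inv_into_f imageI inv_into_into)
    then show "inj_on (\<lambda>y. g (inv_into U f y)) (f ` U)"
      using assms by (auto simp: inj_on_def)
    show "(\<lambda>y. g (inv_into U f y)) ` f ` U = g ` U"
      using key by (auto simp: image_image)
  qed
  then show ?thesis by (rule bij_betw_same_card)
qed

lemma chain_subset_inj_card:
  assumes "chain\<^sub>\<subseteq> C" "\<And>X. X \<in> C \<Longrightarrow> finite X"
  shows "inj_on card C"
  using assms unfolding chain_subset_def inj_on_def
  by (metis card_subset_eq)

lemma chain_subset_Pow_card_le:
  assumes "chain\<^sub>\<subseteq> C" "C \<subseteq> Pow I" "finite I"
  shows "card C \<le> card I + 1"
proof -
  have "inj_on card C"
    using assms by (intro chain_subset_inj_card) (auto dest: finite_subset)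
  moreover have "card ` C \<subseteq> {..card I}"
    using assms by (auto intro: card_mono)
  ultimately show ?thesis
    by (metis Suc_eq_plus1 card_atMost card_inj_on_le finite_atMost)
qed

text \<open>A chain of this size has exactly one set of each cardinality from 0 to
  \<open>card I\<close>, and consecutive sets differ by one point. Along the chain the size of the
  trace on \<open>J\<close> thus starts at 0, grows by at most one per step and ends at
  \<open>card J\<close>, so it takes every value in between. The upper bound holds because the
  traces form a chain again.\<close>

lemma maximal_chain_card_restrict:
  assumes chain: "chain\<^sub>\<subseteq> C" and sub: "C \<subseteq> Pow I" and fin: "finite I"
    and max: "card C = card I + 1" and J: "J \<subseteq> I"
  shows "card ((\<lambda>X. X \<inter> J) ` C) = card J + 1"
proof (rule antisym)
  let ?R = "(\<lambda>X. X \<inter> J) ` C"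
  have finJ: "finite J" using J fin by (rule finite_subset)
  have fin_C: "finite C" using sub fin by (simp add: finite_subset)
  have fin_mem: "finite X" if "X \<in> C" for X using that sub fin by (auto dest: finite_subset)
  have "chain\<^sub>\<subseteq> ?R" using chain unfolding chain_subset_def by blast
  then show "card ?R \<le> card J + 1" by (rule chain_subset_Pow_card_le) (use finJ in auto)
  have "card ` C = {..card I}"
  proof (rule card_subset_eq)
    show "card ` C \<subseteq> {..card I}" using sub fin by (auto intro: card_mono)
    show "card (card ` C) = card {..card I}"
      using max card_image[OF chain_subset_inj_card[OF chain fin_mem]] by simp
  qed simp
  then have "\<forall>c\<le>card I. \<exists>X\<in>C. card X = c" by (metis atMost_iff imageE)
  then obtain X where X: "\<And>c. c \<le> card I \<Longrightarrow> X c \<in> C \<and> card (X c) = c"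
    by metis
  have step: "X c \<subseteq> X (Suc c)" if "Suc c \<le> card I" for c
  proof -
    have "\<not> X (Suc c) \<subseteq> X c"
      using X[OF that] X[of c] that fin_mem card_mono[of "X c" "X (Suc c)"] by fastforce
    then show ?thesis using X[OF that] X[of c] that chain unfolding chain_subset_def by fastforce
  qed
  define g where "g c = int (card (X c \<inter> J))" for c
  have "\<exists>c\<le>card I. g c = int d" if "d \<le> card J" for d
  proof (rule nat0_intermed_int_val)
    show "\<forall>c<card I. \<bar>g (c + 1) - g c\<bar> \<le> 1"
    proof (intro allI impI)
      fix c assume c: "c < card I"
      have fX: "finite (X (Suc c))" "finite (X c)" using X fin_mem c by auto
      have "card (X (Suc c) - X c) = 1"
        using card_Diff_subset[of "X c" "X (Suc c)"] step[of c] X[of c] X[of "Suc c"] c fX by auto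
      moreover have "card ((X (Suc c) - X c) \<inter> J) \<le> card (X (Suc c) - X c)"
        using fX by (intro card_mono) auto
      moreover have "card (X (Suc c) \<inter> J) = card (X c \<inter> J) + card ((X (Suc c) - X c) \<inter> J)"
        using fX step[of c] c by (subst card_Un_disjoint[symmetric]) (auto intro: arg_cong[where f = card])
      ultimately show "\<bar>g (c + 1) - g c\<bar> \<le> 1" by (simp add: g_def)
    qed
    have "X 0 = {}" using X[of 0] fin_mem by auto
    then show "g 0 \<le> int d" by (simp add: g_def)
    have "X (card I) = I" using X[of "card I"] sub by (intro card_subset_eq[OF fin]) auto
    then show "int d \<le> g (card I)" using that J by (simp add: g_def Int_absorb1)
  qed
  then have "{..card J} \<subseteq> card ` ?R"
    using X unfolding g_def by (force simp: image_iff)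
  then have "card {..card J} \<le> card (card ` ?R)" using fin_C by (intro card_mono) auto
  also have "\<dots> \<le> card ?R" using fin_C by (intro card_image_le) auto
  finally show "card J + 1 \<le> card ?R" by simp
qed

lemma chain_upset_cases:
  assumes chain: "chain\<^sub>\<subseteq> C" and fin: "finite C"
    and up: "D \<subseteq> C" "\<And>X Y. X \<in> D \<Longrightarrow> Y \<in> C \<Longrightarrow> X \<subseteq> Y \<Longrightarrow> Y \<in> D"
  obtains "D = {}" | "D = C" | s where "\<And>X. X \<in> C \<Longrightarrow> X \<in> D \<longleftrightarrow> s \<in> X"
proof (cases "D = {} \<or> D = C")
  case True then show ?thesis using that by blast
next
  case False
  then have ne: "D \<noteq> {}" "C - D \<noteq> {}" using up(1) by auto
  have fins: "finite D" "finite (C - D)" using fin up(1) by (auto dest: finite_subset)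
  obtain X where X: "X \<in> D" "\<And>Z. Z \<in> D \<Longrightarrow> Z \<subseteq> X \<Longrightarrow> X = Z"
    using finite_has_minimal[OF fins(1) ne(1)] by blast
  obtain Y where Y: "Y \<in> C - D" "\<And>Z. Z \<in> C - D \<Longrightarrow> Y \<subseteq> Z \<Longrightarrow> Y = Z"
    using finite_has_maximal[OF fins(2) ne(2)] by blast
  have "\<not> X \<subseteq> Y" using X(1) Y(1) up(2) by blast
  then obtain s where s: "s \<in> X" "s \<notin> Y" by blast
  have "Z \<in> D \<longleftrightarrow> s \<in> Z" if Z: "Z \<in> C" for Z
  proof
    assume "Z \<in> D"
    then have "X \<subseteq> Z" using X chain Z up(1) unfolding chain_subset_def by blast
    then show "s \<in> Z" using s(1) by blast
  next
    assume "s \<in> Z"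
    show "Z \<in> D"
    proof (rule ccontr)
      assume "Z \<notin> D"
      then have "Z \<subseteq> Y" using Y chain Z unfolding chain_subset_def by blast
      then show False using \<open>s \<in> Z\<close> s(2) by blast
    qed
  qed
  then show ?thesis by (rule that(3))
qed

text \<open>In a chain, both \<open>{Z. X \<subseteq> Z}\<close> and \<open>{Z. X \<subset> Z}\<close> are up-sets, and every proper
  non-empty up-set is cut out by the membership of a single point.\<close>

lemma chain_multiplicity_determined:
  assumes chain: "chain\<^sub>\<subseteq> C" and fin: "finite C" and finK: "finite K"
    and f: "f ` K \<subseteq> C" and g: "g ` K \<subseteq> C"
    and eq: "\<And>s. card {i \<in> K. s \<in> f i} = card {i \<in> K. s \<in> g i}"
    and X: "X \<in> C"
  shows "card {i \<in> K. f i = X} = card {i \<in> K. g i = X}"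
proof -
  have up: "card {i \<in> K. f i \<in> D} = card {i \<in> K. g i \<in> D}"
    if "D \<subseteq> C" "\<And>X Y. X \<in> D \<Longrightarrow> Y \<in> C \<Longrightarrow> X \<subseteq> Y \<Longrightarrow> Y \<in> D" for D
  proof (rule chain_upset_cases[OF chain fin that])
    assume "D = {}"
    then show ?thesis by simp
  next
    assume "D = C"
    then have "{i \<in> K. f i \<in> D} = K" "{i \<in> K. g i \<in> D} = K" using f g by auto
    then show ?thesis by simp
  next
    fix s assume "\<And>Z. Z \<in> C \<Longrightarrow> Z \<in> D \<longleftrightarrow> s \<in> Z"
    then have "{i \<in> K. f i \<in> D} = {i \<in> K. s \<in> f i}" "{i \<in> K. g i \<in> D} = {i \<in> K. s \<in> g i}"
      using f g by auto
    then show ?thesis using eq by simp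
  qed
  have split: "card {i \<in> K. h i = X} =
      card {i \<in> K. h i \<in> {Z \<in> C. X \<subseteq> Z}} - card {i \<in> K. h i \<in> {Z \<in> C. X \<subset> Z}}"
    if "h ` K \<subseteq> C" for h
  proof -
    have "{i \<in> K. h i = X} =
        {i \<in> K. h i \<in> {Z \<in> C. X \<subseteq> Z}} - {i \<in> K. h i \<in> {Z \<in> C. X \<subset> Z}}"
      using that X by auto
    then show ?thesis using finK by (simp only:) (rule card_Diff_subset, auto)
  qed
  show ?thesis
    unfolding split[OF f] split[OF g]
    by (intro arg_cong2[where f = minus] up) auto
qed

section \<open>Prefix counts\<close>

text \<open>Integer-valued, so that differences of counts do not truncate.\<close>

definition prefix_count :: "'a \<Rightarrow> 'a list \<Rightarrow> nat \<Rightarrow> int" where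
  "prefix_count b u t = int (count_list (take t u) b)"

lemma prefix_count_0 [simp]: "prefix_count b u 0 = 0"
  by (simp add: prefix_count_def)

lemma prefix_count_Suc:
  "t < length u \<Longrightarrow> prefix_count b u (Suc t) = prefix_count b u t + of_bool (u ! t = b)"
  by (simp add: prefix_count_def take_Suc_conv_app_nth)

lemma prefix_count_length: "prefix_count b u (length u) = int (count_list u b)"
  by (simp add: prefix_count_def)

lemma prefix_count_slice:
  "s \<le> j \<Longrightarrow>
    prefix_count b (take j (drop i u)) s = prefix_count b u (i + s) - prefix_count b u i"
  by (simp add: prefix_count_def take_add min_def)

lemma prefix_count_Cons: "prefix_count b (c # u) (Suc t) = of_bool (c = b) + prefix_count b u t"
  by (simp add: prefix_count_def)

lemma prefix_count_append: "t \<le> length u \<Longrightarrow> prefix_count b (u @ v) t = prefix_count b u t"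
  by (simp add: prefix_count_def)

lemma prefix_count_snoc_length:
  "prefix_count b (u @ [c]) (Suc (length u)) = prefix_count b u (length u) + of_bool (c = b)"
  by (simp add: prefix_count_def)

lemma prefix_count_rev:
  assumes "t \<le> length u"
  shows "prefix_count b (rev u) t = prefix_count b u (length u) - prefix_count b u (length u - t)"
proof -
  have "count_list u b = count_list (take (length u - t) u) b + count_list (drop (length u - t) u) b"
    by (metis append_take_drop_id count_list_append)
  then show ?thesis by (simp add: prefix_count_def take_rev)
qed

text \<open>The increment of the count at each position tells whether the letter there is
  \<open>b\<close>, and with two letters this fixes it.\<close>

lemma binary_lists_eqI:
  assumes "set u \<subseteq> {a, b}" "set v \<subseteq> {a, b}" "length u = length v"
    and "\<And>t. t \<le> length u \<Longrightarrow> prefix_count b u t = prefix_count b v t"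
  shows "u = v"
proof (rule nth_equalityI)
  fix i assume i: "i < length u"
  then have "u ! i = b \<longleftrightarrow> v ! i = b"
    using assms(3) assms(4)[of i] assms(4)[of "Suc i"] prefix_count_Suc[of i u b] prefix_count_Suc[of i v b]
    by (auto split: if_splits simp: of_bool_def)
  moreover have "u ! i \<in> {a, b}" using subsetD[OF assms(1) nth_mem[OF i]] .
  moreover have "v ! i \<in> {a, b}" using subsetD[OF assms(2) nth_mem[of i v]] i assms(3) by simp
  ultimately show "u ! i = v ! i" by auto
qed (use assms in simp)

section \<open>Aligned balance and the chain of profiles\<close>

text \<open>Unlike balance, this compares only windows at the same position. It makes sense for any
  set of words, in particular for the factors of one length with a single factor removed.\<close>

definition aligned_balanced :: "'a \<Rightarrow> nat \<Rightarrow> 'a list set \<Rightarrow> bool" where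
  "aligned_balanced b n U \<longleftrightarrow>
     (\<forall>u\<in>U. \<forall>v\<in>U. \<forall>s t. s \<le> t \<longrightarrow> t \<le> n \<longrightarrow>
        (prefix_count b v t - prefix_count b v s) - (prefix_count b u t - prefix_count b u s) \<le> 1)"

text \<open>The positions where the count of \<open>u\<close> is the larger of the two values taken
  on \<open>U\<close>; a position where all of \<open>U\<close> agrees lies in no profile.\<close>

definition profile :: "'a \<Rightarrow> nat \<Rightarrow> 'a list set \<Rightarrow> 'a list \<Rightarrow> nat set" where
  "profile b n U u = {t \<in> {1..n}. \<exists>v\<in>U. prefix_count b v t < prefix_count b u t}"

lemma profile_subset: "profile b n U u \<subseteq> {1..n}"
  by (auto simp: profile_def)

text \<open>Aligned balance with \<open>s = 0\<close> leaves at most two consecutive values for the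
  count at \<open>t\<close>, and membership in the profile selects the larger one.\<close>

lemma prefix_count_diff_profile:
  assumes bal: "aligned_balanced b n U" and u: "u \<in> U" and v: "v \<in> U" and t: "t \<le> n"
  shows "prefix_count b u t - prefix_count b v t =
    of_bool (t \<in> profile b n U u) - of_bool (t \<in> profile b n U v)"
proof (cases "t = 0")
  case False
  have le: "prefix_count b y t - prefix_count b x t \<le> 1" if "x \<in> U" "y \<in> U" for x y
  proof -
    have "(prefix_count b y t - prefix_count b y 0) - (prefix_count b x t - prefix_count b x 0) \<le> 1"
      using bal that t unfolding aligned_balanced_def by blast
    then show ?thesis by simp
  qed
  have less: "t \<in> profile b n U y \<and> t \<notin> profile b n U x \<and>
      prefix_count b y t = prefix_count b x t + 1"
    if xy: "x \<in> U" "y \<in> U" "prefix_count b x t < prefix_count b y t" for x y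
  proof (intro conjI)
    show "t \<in> profile b n U y" using xy t False by (auto simp: profile_def)
    show "prefix_count b y t = prefix_count b x t + 1" using le[OF xy(1,2)] xy(3) by linarith
    have "\<not> prefix_count b v t < prefix_count b x t" if "v \<in> U" for v
      using le[OF that xy(2)] xy(3) by linarith
    then show "t \<notin> profile b n U x" by (auto simp: profile_def)
  qed
  have "t \<in> profile b n U u \<longleftrightarrow> t \<in> profile b n U v" if "prefix_count b u t = prefix_count b v t"
    using that by (simp add: profile_def)
  with less[OF u v] less[OF v u] show ?thesis
    by (cases "prefix_count b u t" "prefix_count b v t" rule: linorder_cases) auto
qed (simp add: profile_def)

lemma profile_Int_eq_iff:
  assumes "aligned_balanced b n U" "u \<in> U" "v \<in> U" "J \<subseteq> {1..n}"
  shows "profile b n U u \<inter> J = profile b n U v \<inter> J \<longleftrightarrow>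
    (\<forall>t\<in>J. prefix_count b u t = prefix_count b v t)"
proof -
  have "prefix_count b u t = prefix_count b v t \<longleftrightarrow>
      (t \<in> profile b n U u \<longleftrightarrow> t \<in> profile b n U v)" if "t \<in> J" for t
    using prefix_count_diff_profile[OF assms(1-3), of t] that assms(4)
    by (auto simp: of_bool_def split: if_splits)
  then show ?thesis by blast
qed

text \<open>If \<open>s\<close> lay only in the profile of \<open>u\<close> and \<open>t\<close>
  only in that of \<open>v\<close>, then on the window between \<open>s\<close> and \<open>t\<close>
  the two words would differ by two in their number of letters \<open>b\<close>.\<close>

lemma chain_profiles:
  assumes bal: "aligned_balanced b n U"
  shows "chain\<^sub>\<subseteq> (profile b n U ` U)"
  unfolding chain_subset_def
proof (intro ballI; elim imageE; hypsubst_thin; rule ccontr)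
  fix u v assume u: "u \<in> U" and v: "v \<in> U"
    and "\<not> (profile b n U u \<subseteq> profile b n U v \<or> profile b n U v \<subseteq> profile b n U u)"
  then obtain s t where s: "s \<in> profile b n U u" "s \<notin> profile b n U v"
    and t: "t \<in> profile b n U v" "t \<notin> profile b n U u" by blast
  then have le: "s \<le> n" "t \<le> n" using profile_subset by fastforce+
  have "prefix_count b u s - prefix_count b v s = 1" "prefix_count b u t - prefix_count b v t = -1"
    using prefix_count_diff_profile[OF bal u v] s t le by auto
  moreover have "(prefix_count b y q - prefix_count b y p) - (prefix_count b x q - prefix_count b x p) \<le> 1"
    if "x \<in> U" "y \<in> U" "p \<le> q" "q \<le> n" for x y p q
    using bal that unfolding aligned_balanced_def by blast
  from this[OF v u, of t s] this[OF u v, of s t]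
  have "s \<le> t \<or> t \<le> s \<Longrightarrow> prefix_count b u s - prefix_count b v s \<le> 1 + (prefix_count b u t - prefix_count b v t)"
    using le by linarith
  ultimately show False by linarith
qed

lemma inj_on_profile:
  assumes "aligned_balanced b n U" and "\<And>u. u \<in> U \<Longrightarrow> length u = n \<and> set u \<subseteq> {a, b}"
  shows "inj_on (profile b n U) U"
proof (rule inj_onI)
  fix u v assume uv: "u \<in> U" "v \<in> U" and eq: "profile b n U u = profile b n U v"
  show "u = v"
  proof (rule binary_lists_eqI)
    fix t assume "t \<le> length u"
    then show "prefix_count b u t = prefix_count b v t"
      using prefix_count_diff_profile[OF assms(1) uv, of t] assms(2)[OF uv(1)] eq by simp
  qed (use assms(2) uv in auto)
qed

lemma aligned_balanced_card_le:
  assumes "aligned_balanced b n U" and "\<And>u. u \<in> U \<Longrightarrow> length u = n \<and> set u \<subseteq> {a, b}"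
  shows "card U \<le> n + 1"
proof -
  have "card U = card (profile b n U ` U)"
    using card_image[OF inj_on_profile[OF assms]] by simp
  also have "\<dots> \<le> card {1..n} + 1"
    by (rule chain_subset_Pow_card_le[OF chain_profiles[OF assms(1)]]) (auto simp: profile_def)
  finally show ?thesis by simp
qed

text \<open>Storing a restriction to \<open>J\<close> as its graph turns agreement on
  \<open>J\<close> into equality of sets, so that distinct restrictions can be counted as elements
  of an image.\<close>

lemma graph_eq_iff:
  "(\<lambda>t. (t, f t)) ` J = (\<lambda>t. (t, g t)) ` J \<longleftrightarrow> (\<forall>t\<in>J. f t = g t)"
proof
  assume eq: "(\<lambda>t. (t, f t)) ` J = (\<lambda>t. (t, g t)) ` J"
  show "\<forall>t\<in>J. f t = g t"
  proof
    fix t assume "t \<in> J"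
    then have "(t, f t) \<in> (\<lambda>t. (t, g t)) ` J" using eq by blast
    then show "f t = g t" by auto
  qed
qed (auto intro: image_cong)

lemma aligned_balanced_card_restrict:
  assumes bal: "aligned_balanced b n U" and U: "\<And>u. u \<in> U \<Longrightarrow> length u = n \<and> set u \<subseteq> {a, b}"
    and card: "card U = n + 1" and J: "J \<subseteq> {1..n}"
  shows "card ((\<lambda>u. (\<lambda>t. (t, prefix_count b u t)) ` J) ` U) = card J + 1"
proof -
  have "card ((\<lambda>u. (\<lambda>t. (t, prefix_count b u t)) ` J) ` U) =
      card ((\<lambda>u. profile b n U u \<inter> J) ` U)"
    by (rule card_image_eq_if_same_kernel) (simp add: graph_eq_iff profile_Int_eq_iff[OF bal _ _ J])
  also have "\<dots> = card ((\<lambda>X. X \<inter> J) ` profile b n U ` U)"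
    by (simp add: image_image)
  also have "\<dots> = card J + 1"
  proof (rule maximal_chain_card_restrict[OF chain_profiles[OF bal] _ _ _ J])
    show "card (profile b n U ` U) = card {1..n} + 1"
      using card_image[OF inj_on_profile[OF bal U]] card by simp
  qed (auto simp: profile_def)
  finally show ?thesis .
qed

section \<open>Factors and right special factors\<close>

lemma factorE:
  assumes "u \<in> factors w n"
  obtains i where "u = w [i \<rightarrow> i + n]"
  using assms unfolding factors_def by blast

lemma subsequence_in_factors: "w [i \<rightarrow> i + n] \<in> factors w n"
  by (auto simp: factors_def)

lemma length_factor: "u \<in> factors w n \<Longrightarrow> length u = n"
  by (auto elim: factorE)

lemma set_factor: "u \<in> factors w n \<Longrightarrow> set u \<subseteq> range w"
  by (elim factorE) auto

lemma slice_in_factors: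
  assumes "u \<in> factors w n" "i + j \<le> n"
  shows "take j (drop i u) \<in> factors w j"
proof -
  obtain k where "u = w [k \<rightarrow> k + n]" using assms(1) by (rule factorE)
  then have "take j (drop i u) = w [k + i \<rightarrow> k + i + j]" using assms(2) by (simp add: min_def)
  then show ?thesis using subsequence_in_factors by metis
qed

lemma finite_factors:
  assumes "finite (range w)"
  shows "finite (factors w n)"
proof (rule finite_subset)
  show "factors w n \<subseteq> {xs. set xs \<subseteq> range w \<and> length xs = n}"
    using set_factor length_factor by blast
  show "finite {xs. set xs \<subseteq> range w \<and> length xs = n}"
    by (rule finite_lists_length_eq[OF assms])
qed

lemma subsequence_eq_iff:
  "w [i \<rightarrow> i + n] = w [j \<rightarrow> j + n] \<longleftrightarrow> (\<forall>t<n. w (i + t) = w (j + t))"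
  by (auto simp: list_eq_iff_nth_eq)

lemma subsequence_Suc_right: "w [i \<rightarrow> i + Suc n] = w [i \<rightarrow> i + n] @ [w (i + n)]"
  by (simp add: subsequence_def)

definition right_special :: "'a word \<Rightarrow> nat \<Rightarrow> 'a list set" where
  "right_special w n = {x \<in> factors w n.
     \<exists>c d. c \<noteq> d \<and> x @ [c] \<in> factors w (Suc n) \<and> x @ [d] \<in> factors w (Suc n)}"

lemma finite_right_special: "finite (range w) \<Longrightarrow> finite (right_special w n)"
  using finite_factors[of w n] by (simp add: right_special_def)

text \<open>A factor that is not right special determines the next letter, hence the next window.
  Two equal windows therefore evolve in the same way as long as no special factor is met, and the
  windows from \<open>q\<close> on keep cycling through those between \<open>q\<close> and
  \<open>q'\<close>.\<close>

lemma ultimately_periodic_if_repeat: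
  assumes less: "q < q'" and eq: "w [q \<rightarrow> q + n] = w [q' \<rightarrow> q' + n]"
    and nonspecial: "\<And>i. q \<le> i \<Longrightarrow> i < q' \<Longrightarrow> w [i \<rightarrow> i + n] \<notin> right_special w n"
  shows "ultimately_periodic w"
proof -
  have step: "w (i + n) = w (j + n) \<and> w [Suc i \<rightarrow> Suc i + n] = w [Suc j \<rightarrow> Suc j + n]"
    if ij: "w [i \<rightarrow> i + n] = w [j \<rightarrow> j + n]" "w [i \<rightarrow> i + n] \<notin> right_special w n" for i j
  proof
    show last: "w (i + n) = w (j + n)"
      using ij subsequence_in_factors[of w i n] subsequence_in_factors[of w i "Suc n"]
        subsequence_in_factors[of w j "Suc n"]
      unfolding subsequence_Suc_right right_special_def by force
    have "w (i + t) = w (j + t)" if "t \<le> n" for t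
      using that ij(1) last unfolding subsequence_eq_iff by (cases "t = n") auto
    then show "w [Suc i \<rightarrow> Suc i + n] = w [Suc j \<rightarrow> Suc j + n]"
      unfolding subsequence_eq_iff by (metis Suc_leI add_Suc add_Suc_right)
  qed
  \<comment> \<open>Every later window repeats one from the first cycle, so non-speciality extends
    from that cycle to all later positions.\<close>
  have cover: "\<exists>i. q \<le> i \<and> i < q' \<and> w [i \<rightarrow> i + n] = w [q + t \<rightarrow> q + t + n]" for t
  proof (induction t)
    case 0
    then show ?case using less by auto
  next
    case (Suc t)
    then obtain i where i: "q \<le> i" "i < q'" "w [i \<rightarrow> i + n] = w [q + t \<rightarrow> q + t + n]" by blast
    then have next_eq: "w [Suc i \<rightarrow> Suc i + n] = w [q + Suc t \<rightarrow> q + Suc t + n]"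
      using step[OF i(3) nonspecial[OF i(1,2)]] by simp
    show ?case
    proof (cases "Suc i = q'")
      case True
      then show ?thesis using next_eq eq less by (intro exI[of _ q]) simp
    next
      case False
      then show ?thesis using next_eq i by (intro exI[of _ "Suc i"]) simp
    qed
  qed
  have ns: "w [q + t \<rightarrow> q + t + n] \<notin> right_special w n" for t
    using cover[of t] nonspecial by metis
  have rep: "w [q + t \<rightarrow> q + t + n] = w [q' + t \<rightarrow> q' + t + n]" for t
  proof (induction t)
    case (Suc t)
    then show ?case using step[OF Suc ns] by simp
  qed (use eq in simp)
  have "w (i + (q' - q)) = w i" if "i \<ge> q + n" for i
  proof -
    obtain t where t: "i = q + t + n" using \<open>i \<ge> q + n\<close> by (metis add.assoc add.commute le_iff_add)
    then show ?thesis using step[OF rep ns, of t] less by (simp add: add.commute add.left_commute)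
  qed
  then show ?thesis unfolding ultimately_periodic_def
    using less by (intro exI[of _ "q' - q"] conjI exI[of _ "q + n"]) auto
qed

text \<open>Pigeonhole: \<open>n + 1\<close> consecutive windows take at most \<open>n\<close>
  values, so two of them coincide with no special factor in between.\<close>

lemma ultimately_periodic_if_nonspecial_run:
  assumes fin: "finite V" and card: "card V \<le> n"
    and run: "\<And>i. p \<le> i \<Longrightarrow> i \<le> p + n \<Longrightarrow> w [i \<rightarrow> i + l] \<in> V \<and> w [i \<rightarrow> i + l] \<notin> right_special w l"
  shows "ultimately_periodic w"
proof -
  have "\<not> inj_on (\<lambda>i. w [i \<rightarrow> i + l]) {p..p + n}"
  proof
    assume "inj_on (\<lambda>i. w [i \<rightarrow> i + l]) {p..p + n}"
    then have "card {p..p + n} \<le> card V" by (rule card_inj_on_le) (use run fin in auto)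
    then show False using card by simp
  qed
  then obtain q q' where "q < q'" "p \<le> q" "q' \<le> p + n" "w [q \<rightarrow> q + l] = w [q' \<rightarrow> q' + l]"
    unfolding inj_on_def by (metis atLeastAtMost_iff nat_neq_iff)
  then show ?thesis using run by (intro ultimately_periodic_if_repeat[of q q' w l]) auto
qed

text \<open>Every factor has a continuation \<open>e x\<close>, and every right special one has a
  second continuation \<open>e' x\<close>; all these words are distinct.\<close>

lemma card_factors_Suc_ge:
  assumes fin: "finite (range w)"
  shows "card (factors w n) + card (right_special w n) \<le> card (factors w (Suc n))"
proof -
  have "\<forall>x\<in>factors w n. \<exists>c. x @ [c] \<in> factors w (Suc n)"
    by (metis factorE subsequence_Suc_right subsequence_in_factors)
  then obtain e where e: "\<And>x. x \<in> factors w n \<Longrightarrow> x @ [e x] \<in> factors w (Suc n)" by metis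
  have "\<forall>x\<in>right_special w n. \<exists>c. c \<noteq> e x \<and> x @ [c] \<in> factors w (Suc n)"
    unfolding right_special_def by (clarify, metis)
  then obtain e' where e': "\<And>x. x \<in> right_special w n \<Longrightarrow> e' x \<noteq> e x \<and> x @ [e' x] \<in> factors w (Suc n)"
    by metis
  let ?E = "(\<lambda>x. x @ [e x]) ` factors w n" and ?E' = "(\<lambda>x. x @ [e' x]) ` right_special w n"
  have "card (factors w n) + card (right_special w n) = card ?E + card ?E'"
    by (simp add: card_image inj_on_def)
  also have "\<dots> = card (?E \<union> ?E')"
  proof (rule card_Un_disjoint[symmetric])
    show "?E \<inter> ?E' = {}"
    proof (rule equals0I)
      fix z assume "z \<in> ?E \<inter> ?E'"
      then obtain x y where "y \<in> right_special w n" "x @ [e x] = y @ [e' y]" by blast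
      then show False using e'[of y] by auto
    qed
  qed (use finite_factors[OF fin] finite_right_special[OF fin] in auto)
  also have "\<dots> \<le> card (factors w (Suc n))"
    using finite_factors[OF fin] e e' by (intro card_mono) auto
  finally show ?thesis .
qed

lemma right_special_nonempty:
  assumes "finite (range w)" and aper: "aperiodic w"
  shows "right_special w n \<noteq> {}"
proof
  assume "right_special w n = {}"
  then have "ultimately_periodic w"
    using finite_factors[OF assms(1), of n] subsequence_in_factors
    by (intro ultimately_periodic_if_nonspecial_run[of "factors w n" "card (factors w n)" 0]) auto
  then show False using aper by simp
qed

text \<open>The Morse-Hedlund bound: each length has a right special factor, so the number of
  factors grows by at least one at each step.\<close>

lemma aperiodic_card_factors_ge:
  assumes "finite (range w)" "aperiodic w"
  shows "n + 1 \<le> card (factors w n)"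
proof (induction n)
  case 0
  have "factors w 0 = {[]}" by (auto simp: factors_def)
  then show ?case by simp
next
  case (Suc n)
  have "card (right_special w n) \<noteq> 0"
    using right_special_nonempty[OF assms] finite_right_special[OF assms(1)] by simp
  then show ?case using Suc card_factors_Suc_ge[OF assms(1), of n] by linarith
qed

lemma tl_right_special:
  assumes "x \<in> right_special w (Suc n)"
  shows "tl x \<in> right_special w n"
proof -
  obtain c d where x: "x \<in> factors w (Suc n)" and cd: "c \<noteq> d"
    "x @ [c] \<in> factors w (Suc (Suc n))" "x @ [d] \<in> factors w (Suc (Suc n))"
    using assms unfolding right_special_def by blast
  have len: "length x = Suc n" using length_factor[OF x] .
  have "tl x = take n (drop 1 x)" using len by (simp add: drop_Suc)
  then have "tl x \<in> factors w n" using slice_in_factors[OF x, of 1 n] by simp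
  moreover have "tl x @ [e] = take (Suc n) (drop 1 (x @ [e]))" for e
    using len by (cases x) auto
  ultimately show ?thesis
    using cd slice_in_factors[OF cd(2), of 1 "Suc n"] slice_in_factors[OF cd(3), of 1 "Suc n"]
    unfolding right_special_def by auto
qed

section \<open>Balance\<close>

text \<open>Balance at one length, counting a single letter; in a binary word the count of the other
  letter is complementary. Exchanging \<open>u\<close> and \<open>v\<close> gives the opposite
  inequality.\<close>

definition balanced_at :: "'a \<Rightarrow> 'a word \<Rightarrow> nat \<Rightarrow> bool" where
  "balanced_at b w n \<longleftrightarrow>
     (\<forall>u\<in>factors w n. \<forall>v\<in>factors w n. count_list v b \<le> count_list u b + 1)"

lemma balanced_at_slice_le:
  assumes "balanced_at b w n" "u \<in> factors w m" "v \<in> factors w l" "s + n \<le> m" "t + n \<le> l"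
  shows "prefix_count b v (t + n) - prefix_count b v t \<le> prefix_count b u (s + n) - prefix_count b u s + 1"
proof -
  let ?u = "take n (drop s u)" and ?v = "take n (drop t v)"
  have uv: "?u \<in> factors w n" "?v \<in> factors w n" using slice_in_factors assms(2-5) by blast+
  then have "int (count_list ?v b) \<le> int (count_list ?u b) + 1"
    using assms(1) unfolding balanced_at_def by fastforce
  then have "prefix_count b ?v n \<le> prefix_count b ?u n + 1"
    using prefix_count_length[of b ?u] prefix_count_length[of b ?v] length_factor[OF uv(1)]
      length_factor[OF uv(2)] by simp
  then show ?thesis by (simp add: prefix_count_slice)
qed

lemma aligned_balanced_factors:
  assumes "\<And>j. j \<le> n \<Longrightarrow> balanced_at b w j"
  shows "aligned_balanced b n (factors w n)"
  unfolding aligned_balanced_def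
proof (intro ballI allI impI)
  fix u v s t assume uv: "u \<in> factors w n" "v \<in> factors w n" and st: "s \<le> t" "t \<le> n"
  then show "(prefix_count b v t - prefix_count b v s) - (prefix_count b u t - prefix_count b u s) \<le> 1"
    using balanced_at_slice_le[OF assms[of "t - s"] uv, of s s] by simp
qed

text \<open>From an occurrence of \<open>d # B @ [d]\<close> on, \<open>length B + 2\<close>
  consecutive windows of length \<open>length B + 1\<close> avoid \<open>c # B\<close>, the only
  possible right special factor. At most \<open>length B + 1\<close> other factors are available, so
  the pigeonhole argument applies.\<close>

lemma ultimately_periodic_if_palindromic_extension:
  assumes fin: "finite (range w)" and neq: "c \<noteq> d" and pal: "rev B = B"
    and ext: "d # B @ [d] \<in> factors w (Suc (Suc (length B)))"
    and sp: "c # B \<in> factors w (Suc (length B))"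
    and card: "card (factors w (Suc (length B))) \<le> Suc (length B) + 1"
    and special: "right_special w (Suc (length B)) \<subseteq> {c # B}"
  shows "ultimately_periodic w"
proof -
  let ?L = "length B"
  obtain p where p: "d # B @ [d] = w [p \<rightarrow> p + Suc (Suc ?L)]" using ext by (rule factorE)
  have nth: "w (p + t) = (d # B @ [d]) ! t" if "t < Suc (Suc ?L)" for t
    unfolding p by (rule subsequence_nth[symmetric]) (use that in simp)
  text \<open>An occurrence of \<open>c # B\<close> overlapping \<open>d # B @ [d]\<close> makes some letter of \<open>B\<close> equal to
    \<open>c\<close> and the letter of \<open>B\<close> at the mirrored position equal to \<open>d\<close>.\<close>
  have run: "w [p + s \<rightarrow> p + s + Suc ?L] \<noteq> c # B" if s: "s \<le> Suc ?L" for s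
  proof
    assume "w [p + s \<rightarrow> p + s + Suc ?L] = c # B"
    then have B: "w (p + s + t) = (c # B) ! t" if "t < Suc ?L" for t
      using that subsequence_nth[of t "p + s + Suc ?L" "p + s" w] by simp
    have c: "(d # B @ [d]) ! s = c" using B[of 0] nth[of s] that by simp
    show False
    proof (cases "s = 0 \<or> s = Suc ?L")
      \<comment> \<open>At either end of \<open>d # B @ [d]\<close> the letter is \<open>d\<close>,
        whereas the window would have to start with \<open>c\<close>.\<close>
      case True
      then show False using c neq by (auto simp: nth_append)
    next
      case False
      then obtain r where r: "s = Suc r" "r < ?L" using s by (cases s) auto
      have "B ! r = c" using c r by (simp add: nth_append)
      moreover have "B ! (?L - Suc r) = d"
      proof -
        have idx: "p + s + Suc (?L - Suc r) = p + Suc ?L" using r by simp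
        have "w (p + Suc ?L) = B ! (?L - Suc r)" using B[of "Suc (?L - Suc r)", unfolded idx] r by simp
        then show ?thesis using nth[of "Suc ?L"] by (simp add: nth_append)
      qed
      moreover have "B ! (?L - Suc r) = B ! r"
        using rev_nth[OF r(2)] pal by simp
      ultimately show False using neq by simp
    qed
  qed
  show ?thesis
  proof (rule ultimately_periodic_if_nonspecial_run)
    show "finite (factors w (Suc ?L) - {c # B})" using finite_factors[OF fin] by simp
    show "card (factors w (Suc ?L) - {c # B}) \<le> Suc ?L"
      using card sp finite_factors[OF fin] by (simp add: card_Diff_singleton)
    fix i assume i: "p \<le> i" "i \<le> p + Suc ?L"
    then have "w [i \<rightarrow> i + Suc ?L] \<noteq> c # B" using run[of "i - p"] by simp
    then show "w [i \<rightarrow> i + Suc ?L] \<in> factors w (Suc ?L) - {c # B} \<and>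
        w [i \<rightarrow> i + Suc ?L] \<notin> right_special w (Suc ?L)"
      using special subsequence_in_factors[of w i "Suc ?L"] by blast
  qed
qed

section \<open>Minimal failures of balance in a binary word\<close>

locale binary_word =
  fixes w :: "'a word" and a b :: 'a
  assumes neq: "a \<noteq> b" and range_eq: "range w = {a, b}"
begin

lemma finite_range: "finite (range w)"
  by (simp add: range_eq)

lemma binary_factor: "u \<in> factors w n \<Longrightarrow> length u = n \<and> set u \<subseteq> {a, b}"
  using length_factor set_factor range_eq by metis

lemma balanced_card_le:
  assumes "\<And>j. j \<le> n \<Longrightarrow> balanced_at b w j"
  shows "card (factors w n) \<le> n + 1"
  by (rule aligned_balanced_card_le[OF aligned_balanced_factors[OF assms] binary_factor])

text \<open>The counts of \<open>v\<close> exceed those of \<open>u\<close> by exactly 1 at every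
  inner position and by exactly 2 at the end, so the two words differ in their first and last
  letters and nowhere else.\<close>

lemma minimal_unbalanced_form:
  assumes min: "\<And>j. j < m \<Longrightarrow> balanced_at b w j"
    and u: "u \<in> factors w m" and v: "v \<in> factors w m"
    and gap: "prefix_count b u m + 2 \<le> prefix_count b v m"
  obtains B where "u = a # B @ [a]" "v = b # B @ [b]"
proof -
  note U = binary_factor[OF u] and V = binary_factor[OF v]
  \<comment> \<open>Balance of the prefixes of length \<open>t\<close> bounds the difference above
    by 1; balance of the complementary suffixes, with total gap at least 2, bounds it below by
    1.\<close>
  have inner: "prefix_count b v t = prefix_count b u t + 1" if "0 < t" "t < m" for t
    using balanced_at_slice_le[OF min[OF that(2)] u v, of 0 0]
      balanced_at_slice_le[OF min[of "m - t"] u v, of t t] that gap by simp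
  have "m \<noteq> 0" using gap by (intro notI) simp
  moreover have "m \<noteq> 1"
    using gap prefix_count_Suc[of 0 u b] prefix_count_Suc[of 0 v b] U V
    by (intro notI) (auto simp: of_bool_def split: if_splits)
  ultimately obtain L where L: "m = Suc (Suc L)" by (metis One_nat_def not0_implies_Suc)
  have total: "prefix_count b v m = prefix_count b u m + 2"
    using balanced_at_slice_le[OF min[of "m - 1"] u v, of 1 1] inner[of 1] gap L by simp
  have mem: "u ! t \<in> {a, b}" "v ! t \<in> {a, b}" if "t < m" for t
    using subsetD[OF conjunct2[OF U] nth_mem, of t] subsetD[OF conjunct2[OF V] nth_mem, of t] that U V
    by simp_all
  have first: "u ! 0 = a" "v ! 0 = b"
    using prefix_count_Suc[of 0 u b] prefix_count_Suc[of 0 v b] inner[of 1] U V L mem[of 0]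
    by (auto simp: of_bool_def split: if_splits)
  have last: "u ! Suc L = a" "v ! Suc L = b"
    using prefix_count_Suc[of "Suc L" u b] prefix_count_Suc[of "Suc L" v b] inner[of "Suc L"] total
      U V L mem[of "Suc L"]
    by (auto simp: of_bool_def split: if_splits)
  have middle: "u ! Suc t = v ! Suc t" if "t < L" for t
    using prefix_count_Suc[of "Suc t" u b] prefix_count_Suc[of "Suc t" v b]
      inner[of "Suc t"] inner[of "Suc (Suc t)"] U V L mem[of "Suc t"] that
    by (auto simp: of_bool_def split: if_splits)
  have decomp: "x = x ! 0 # butlast (tl x) @ [x ! Suc L]" if "length x = m" for x :: "'a list"
    using that L by (cases x; cases "tl x" rule: rev_cases) auto
  have "butlast (tl u) = butlast (tl v)"
    by (rule nth_equalityI) (use U V L middle in \<open>auto simp: nth_butlast nth_tl\<close>)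
  then show thesis
    using decomp[of u] decomp[of v] U V first last by (intro that[of "butlast (tl u)"]) auto
qed

lemma minimal_unbalanced_palindrome:
  assumes min: "\<And>j. j < m \<Longrightarrow> balanced_at b w j"
    and aBa: "a # B @ [a] \<in> factors w m" and bBb: "b # B @ [b] \<in> factors w m"
  shows "rev B = B"
proof (rule binary_lists_eqI)
  show "set (rev B) \<subseteq> {a, b}" "set B \<subseteq> {a, b}" using binary_factor[OF aBa] by auto
  fix t assume "t \<le> length (rev B)"
  then have t: "t \<le> length B" by simp
  let ?L = "length B" and ?\<beta> = "prefix_count b B"
  have m: "m = Suc (Suc ?L)" using binary_factor[OF aBa] by simp
  have inner: "prefix_count b (c # B @ [c]) (Suc i) = of_bool (c = b) + ?\<beta> i" if "i \<le> ?L" for c i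
    using that by (simp add: prefix_count_Cons prefix_count_append)
  have total: "prefix_count b (c # B @ [c]) m = 2 * of_bool (c = b) + ?\<beta> ?L" for c
    by (simp add: m prefix_count_Cons prefix_count_snoc_length)
  have bal: "balanced_at b w (Suc t)" using min m t by simp
  have "Suc (?L - t) + Suc t = m" using m t by simp
  \<comment> \<open>Each of the two inequalities compares a prefix of length \<open>Suc t\<close> of
    one word with the suffix of that length of the other. Together they show that the prefix and the
    suffix of \<open>B\<close> of length \<open>t\<close> contain equally many letters
    \<open>b\<close>.\<close>
  then have "?\<beta> t = ?\<beta> ?L - ?\<beta> (?L - t)"
    using balanced_at_slice_le[OF bal aBa bBb, of 0 "Suc (?L - t)"]
      balanced_at_slice_le[OF bal aBa bBb, of "Suc (?L - t)" 0]
      inner[of t] inner[of "?L - t"] total m t neq by simp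
  then show "prefix_count b (rev B) t = ?\<beta> t" using prefix_count_rev[OF t] by simp
qed simp

text \<open>With at most \<open>m + 1\<close> factors of length \<open>m\<close>, there is a single
  right special factor \<open>X\<close> of length \<open>m - 1\<close>. Its tail is right special,
  as is \<open>B\<close>, and there is only one such factor of length \<open>m - 2\<close>; so
  \<open>X\<close> is \<open>a # B\<close> or \<open>b # B\<close>. The extension of the palindrome
  \<open>B\<close> by the other letter on both sides then makes the word ultimately
  periodic.\<close>

lemma minimal_unbalanced_card_ge:
  assumes aper: "aperiodic w" and min: "\<And>j. j < m \<Longrightarrow> balanced_at b w j"
    and aBa: "a # B @ [a] \<in> factors w m" and bBb: "b # B @ [b] \<in> factors w m"
  shows "m + 2 \<le> card (factors w m)"
proof (rule ccontr)
  assume "\<not> m + 2 \<le> card (factors w m)"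
  then have card_m: "card (factors w m) \<le> m + 1" by simp
  let ?L = "length B"
  have m: "m = Suc (Suc ?L)" using binary_factor[OF aBa] by simp
  have ge: "n + 1 \<le> card (factors w n)" for n
    by (rule aperiodic_card_factors_ge[OF finite_range aper])
  have card_Suc_L: "card (factors w (Suc ?L)) \<le> Suc ?L + 1"
    using balanced_card_le[of "Suc ?L"] min m by simp
  \<comment> \<open>There are at least \<open>m\<close> factors of length \<open>m - 1\<close> and
    at most \<open>m + 1\<close> of length \<open>m\<close>, and each special factor accounts for an
    increase of one.\<close>
  have "card (right_special w (Suc ?L)) \<le> 1"
    using card_factors_Suc_ge[OF finite_range, of "Suc ?L"] ge[of "Suc ?L"] card_m m by simp
  then obtain X where X: "right_special w (Suc ?L) = {X}"
    using right_special_nonempty[OF finite_range aper, of "Suc ?L"]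
      finite_right_special[OF finite_range, of "Suc ?L"]
    by (metis One_nat_def card_0_eq card_1_singletonE le_SucE le_zero_eq)
  have slice: "B @ [c] \<in> factors w (Suc ?L)" "B \<in> factors w ?L" "c # B \<in> factors w (Suc ?L)"
    if "c # B @ [c] \<in> factors w m" for c
    using slice_in_factors[OF that, of 1 "Suc ?L"] slice_in_factors[OF that, of 1 ?L]
      slice_in_factors[OF that, of 0 "Suc ?L"] m by auto
  have B: "B \<in> right_special w ?L"
    using slice[OF aBa] slice[OF bBb] neq unfolding right_special_def by blast
  have "card (right_special w ?L) \<le> 1"
    using card_factors_Suc_ge[OF finite_range, of ?L] ge[of ?L] card_Suc_L by simp
  moreover have "tl X \<in> right_special w ?L" using X tl_right_special by blast
  ultimately have "tl X = B"
    using B finite_right_special[OF finite_range, of ?L] by (metis One_nat_def card_le_Suc0_iff_eq)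
  moreover have "length X = Suc ?L \<and> set X \<subseteq> {a, b}"
    using X binary_factor unfolding right_special_def by blast
  ultimately have "X = a # B \<or> X = b # B" by (cases X) auto
  moreover have "ultimately_periodic w" if "X = c # B" "c \<noteq> d"
    "d # B @ [d] \<in> factors w m" "c # B @ [c] \<in> factors w m" for c d
    by (rule ultimately_periodic_if_palindromic_extension[of _ c d B])
      (use that X finite_range card_Suc_L slice m minimal_unbalanced_palindrome[OF min aBa bBb] in auto)
  ultimately show False using aper neq aBa bBb by metis
qed

lemma unbalanced_minimal:
  assumes "\<not> balanced_at b w n"
  obtains m B where "\<And>j. j < m \<Longrightarrow> balanced_at b w j"
    "a # B @ [a] \<in> factors w m" "b # B @ [b] \<in> factors w m"
proof -
  define m where "m = (LEAST n. \<not> balanced_at b w n)"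
  have m: "\<not> balanced_at b w m" unfolding m_def by (rule LeastI[of "\<lambda>n. \<not> balanced_at b w n", OF assms])
  have min: "balanced_at b w j" if "j < m" for j
    using that not_less_Least unfolding m_def by blast
  obtain u v where uv: "u \<in> factors w m" "v \<in> factors w m" "\<not> count_list v b \<le> count_list u b + 1"
    using m unfolding balanced_at_def by blast
  then have "prefix_count b u m + 2 \<le> prefix_count b v m"
    using binary_factor prefix_count_length[of b u] prefix_count_length[of b v] by fastforce
  from minimal_unbalanced_form[OF min uv(1,2) this] show thesis
    using that[OF min] uv by metis
qed

lemma balanced_if_sturmian:
  assumes "aperiodic w" "\<And>n. card (factors w n) = n + 1"
  shows "balanced_at b w n"
proof (rule ccontr)
  assume unbal: "\<not> balanced_at b w n"
  show False
  proof (rule unbalanced_minimal[OF unbal])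
    fix m B assume "\<And>j. j < m \<Longrightarrow> balanced_at b w j"
      "a # B @ [a] \<in> factors w m" "b # B @ [b] \<in> factors w m"
    then have "m + 2 \<le> card (factors w m)" by (rule minimal_unbalanced_card_ge[OF assms(1)])
    then show False using assms(2)[of m] by simp
  qed
qed

end

section \<open>Consequences of k-Abelian equivalence\<close>

lemma finite_occurrence_positions: "finite {i. i + length x \<le> length u \<and> P i}"
  by (rule finite_subset[of _ "{..length u}"]) auto

text \<open>An occurrence of \<open>x\<close> either starts the word or is preceded by a unique
  letter \<open>c\<close>, in which case it comes from an occurrence of \<open>c # x\<close>. This
  lets counts of factors detect prefixes.\<close>

lemma occurrences_eq_prefix_plus_left_extensions:
  assumes fin: "finite A" and u: "u \<in> lists A"
  shows "occurrences u x =
    of_bool (length x \<le> length u \<and> take (length x) u = x) + (\<Sum>c\<in>A. occurrences u (c # x))"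
proof -
  let ?S = "\<lambda>x. {i. i + length x \<le> length u \<and> take (length x) (drop i u) = x}"
  let ?P = "{i::nat. i = 0 \<and> length x \<le> length u \<and> take (length x) u = x}"
  have slice: "take (Suc l) (drop i u) = u ! i # take l (drop (Suc i) u)" if "i < length u" for i l
    using that by (metis Cons_nth_drop_Suc take_Suc_Cons)
  have ext: "Suc i \<in> ?S x \<longleftrightarrow> (\<exists>c\<in>A. i \<in> ?S (c # x))" for i
  proof (cases "i < length u")
    case True
    then have "u ! i \<in> A" using u by (auto simp: in_lists_conv_set)
    then show ?thesis using slice[OF True] by auto
  qed auto
  have split: "?S x = ?P \<union> (\<Union>c\<in>A. Suc ` ?S (c # x))"
  proof (intro set_eqI)
    fix i
    show "i \<in> ?S x \<longleftrightarrow> i \<in> ?P \<union> (\<Union>c\<in>A. Suc ` ?S (c # x))"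
      using ext by (cases i) auto
  qed
  have finS: "finite (Suc ` ?S y)" for y by (intro finite_imageI finite_occurrence_positions)
  have "card (Suc ` ?S y) = occurrences u y" for y
    unfolding occurrences_def by (rule card_image) simp
  moreover have "card (\<Union>c\<in>A. Suc ` ?S (c # x)) = (\<Sum>c\<in>A. card (Suc ` ?S (c # x)))"
    by (rule card_UN_disjoint[OF fin]) (use finS in blast, auto)
  ultimately have cardU: "card (\<Union>c\<in>A. Suc ` ?S (c # x)) = (\<Sum>c\<in>A. occurrences u (c # x))"
    by (simp only:)
  have P: "finite ?P" by (rule finite_subset[of _ "{0}"]) auto
  have cardP: "card ?P = of_bool (length x \<le> length u \<and> take (length x) u = x)"
  proof (cases "length x \<le> length u \<and> take (length x) u = x")
    case True
    then have "?P = {0}" by blast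
    then show ?thesis using True by simp
  next
    case False
    then have "?P = {}" by blast
    show ?thesis unfolding \<open>?P = {}\<close> using False by simp
  qed
  have "card (?P \<union> (\<Union>c\<in>A. Suc ` ?S (c # x))) = card ?P + card (\<Union>c\<in>A. Suc ` ?S (c # x))"
  proof (rule card_Un_disjoint)
    show "finite (\<Union>c\<in>A. Suc ` ?S (c # x))" using fin finS by blast
  qed (use P in auto)
  then show ?thesis unfolding occurrences_def[of u x] split cardP cardU .
qed

text \<open>Reversal sends an occurrence at \<open>i\<close> to one at
  \<open>length u - length x - i\<close>, and this map is its own inverse on the positions
  concerned.\<close>

lemma occurrences_rev: "occurrences (rev u) (rev x) = occurrences u x"
proof -
  let ?S = "\<lambda>u x. {i. i + length x \<le> length u \<and> take (length x) (drop i u) = x}"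
  have mirror: "take (length x) (drop (length u - length x - i) (rev u)) = rev (take (length x) (drop i u))"
    if "i + length x \<le> length u" for i
    using that by (simp add: drop_rev take_rev drop_take add.commute)
  have "bij_betw (\<lambda>i. length u - length x - i) (?S u x) (?S (rev u) (rev x))"
  proof (rule bij_betw_byWitness[where f' = "\<lambda>i. length u - length x - i"])
    show "(\<lambda>i. length u - length x - i) ` ?S u x \<subseteq> ?S (rev u) (rev x)"
      using mirror by auto
    show "(\<lambda>i. length u - length x - i) ` ?S (rev u) (rev x) \<subseteq> ?S u x"
    proof clarify
      fix i assume i: "i + length (rev x) \<le> length (rev u)"
        "take (length (rev x)) (drop i (rev u)) = rev x"
      then show "length u - length x - i + length x \<le> length u \<and>
          take (length x) (drop (length u - length x - i) u) = x"
        using mirror[of "length u - length x - i"] by simp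
    qed
  qed auto
  from bij_betw_same_card[OF this] show ?thesis unfolding occurrences_def by (rule sym)
qed

lemma occurrences_singleton: "occurrences u [c] = count_list u c"
proof -
  have "{i. i + length [c] \<le> length u \<and> take (length [c]) (drop i u) = [c]} =
      {i. i < length u \<and> c = u ! i}"
    by (auto simp: take_Suc hd_drop_conv_nth)
  then show ?thesis
    unfolding occurrences_def by (simp add: count_list_eq_length_filter length_filter_conv_card)
qed

lemma k_abelian_equiv_rev:
  assumes "(u, v) \<in> k_abelian_equiv A k"
  shows "(rev u, rev v) \<in> k_abelian_equiv A k"
proof -
  have "occurrences (rev u) x = occurrences (rev v) x"
    if "x \<in> lists A" "x \<noteq> []" "enat (length x) \<le> k" for x
    using assms that occurrences_rev[of u "rev x"] occurrences_rev[of v "rev x"]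
    unfolding k_abelian_equiv_def by (auto simp: in_lists_conv_set)
  then show ?thesis using assms unfolding k_abelian_equiv_def by (auto simp: in_lists_conv_set)
qed

text \<open>For the prefix \<open>x\<close> of \<open>u\<close>, both \<open>x\<close> and all
  \<open>c # x\<close> have length at most \<open>k\<close>, so their counts agree in
  \<open>u\<close> and \<open>v\<close>. The difference of these counts tells whether a word starts
  with \<open>x\<close>.\<close>

lemma k_abelian_equiv_take_eq:
  assumes fin: "finite A" and eq: "(u, v) \<in> k_abelian_equiv A k"
    and len: "length u = length v" and t: "enat t < k"
  shows "take t u = take t v"
proof (cases "take t u = []")
  case True
  then show ?thesis using len by auto
next
  case False
  let ?x = "take t u" and ?s = "min t (length u)"
  have uv: "u \<in> lists A" "v \<in> lists A"
    and occ: "\<And>x. x \<in> lists A \<Longrightarrow> x \<noteq> [] \<Longrightarrow> enat (length x) \<le> k \<Longrightarrow> occurrences u x = occurrences v x"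
    using eq unfolding k_abelian_equiv_def by auto
  have x: "?x \<in> lists A" "length ?x = ?s"
    using uv(1) by (auto simp: in_lists_conv_set min.commute dest: in_set_takeD)
  have "enat ?s \<le> enat t" by simp
  then have s: "enat ?s < k" using t by (rule le_less_trans)
  then have Suc_s: "enat (Suc ?s) \<le> k" using ileI1[OF s] by (simp add: eSuc_enat)
  have "occurrences u ?x = occurrences v ?x"
    using occ[OF x(1) False] x(2) s by (simp add: order.strict_implies_order)
  moreover have "(\<Sum>c\<in>A. occurrences u (c # ?x)) = (\<Sum>c\<in>A. occurrences v (c # ?x))"
    using occ x Suc_s by (intro sum.cong) auto
  ultimately have "of_bool (?s \<le> length u \<and> take ?s u = ?x) =
      (of_bool (?s \<le> length v \<and> take ?s v = ?x) :: nat)"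
    using occurrences_eq_prefix_plus_left_extensions[OF fin uv(1), of ?x]
      occurrences_eq_prefix_plus_left_extensions[OF fin uv(2), of ?x] x(2) by simp
  moreover have "take ?s u = take t u" "take ?s v = take t v"
    using len by (auto simp: min_def)
  ultimately show ?thesis using len by (simp add: of_bool_def split: if_splits)
qed

lemma k_abelian_equiv_count_eq:
  assumes "(u, v) \<in> k_abelian_equiv A k" "1 \<le> k" "c \<in> A"
  shows "count_list u c = count_list v c"
  using assms unfolding k_abelian_equiv_def occurrences_singleton[symmetric]
  by (auto simp: one_enat_def)

section \<open>Positions seen by k-Abelian equivalence\<close>

text \<open>Position 0 is left out because its count is always 0. For \<open>1 \<le> n\<close> and
  \<open>0 < k\<close>, position \<open>n\<close> is included and records the total number of
  letters \<open>b\<close>.\<close>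

definition boundary_positions :: "enat \<Rightarrow> nat \<Rightarrow> nat set" where
  "boundary_positions k n = {t \<in> {1..n}. enat t < k \<or> enat (n - t) < k}"

lemma boundary_positions_subset: "boundary_positions k n \<subseteq> {1..n}"
  by (auto simp: boundary_positions_def)

lemma card_boundary_positions:
  assumes "1 \<le> k"
  shows "card (boundary_positions k n) + 1 = sturmian_complexity k n"
proof (cases k)
  case (enat m)
  then have m: "1 \<le> m" using assms by (simp add: one_enat_def)
  show ?thesis
  proof (cases "n \<le> 2 * m - 1")
    case True
    then have "boundary_positions k n = {1..n}" using m by (auto simp: boundary_positions_def enat)
    then show ?thesis using True by (simp add: sturmian_complexity_def enat)
  next
    case False
    \<comment> \<open>The left end contributes \<open>m - 1\<close> positions and the right end
      \<open>m\<close>, since \<open>n\<close> itself counts; they are disjoint because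
      \<open>2 * m \<le> n\<close>.\<close>
    then have "boundary_positions k n = {1..<m} \<union> {Suc n - m..n}"
      using m by (auto simp: boundary_positions_def enat)
    moreover have "card ({1..<m} \<union> {Suc n - m..n}) = card {1..<m} + card {Suc n - m..n}"
      using False by (intro card_Un_disjoint) auto
    ultimately show ?thesis using False m by (simp add: sturmian_complexity_def enat)
  qed
next
  case infinity
  then have "boundary_positions k n = {1..n}" by (auto simp: boundary_positions_def)
  then show ?thesis by (simp add: sturmian_complexity_def infinity)
qed

text \<open>Near the left end the prefixes themselves agree. Near the right end the suffixes agree,
  by reversal, and are subtracted from the equal total counts.\<close>

lemma k_abelian_equiv_prefix_count_eq:
  assumes fin: "finite A" and eq: "(u, v) \<in> k_abelian_equiv A k" and k: "1 \<le> k" and b: "b \<in> A"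
    and len: "length u = n" "length v = n" and t: "t \<in> boundary_positions k n"
  shows "prefix_count b u t = prefix_count b v t"
proof (cases "enat t < k")
  case True
  then show ?thesis
    using k_abelian_equiv_take_eq[OF fin eq _ True] len by (simp add: prefix_count_def)
next
  case False
  then have t: "t \<le> n" "enat (n - t) < k" using t by (auto simp: boundary_positions_def)
  have "take (n - t) (rev u) = take (n - t) (rev v)"
    using k_abelian_equiv_take_eq[OF fin k_abelian_equiv_rev[OF eq] _ t(2)] len by simp
  then have "count_list (drop t u) b = count_list (drop t v) b"
    using len t(1) by (simp add: take_rev)
  moreover have split: "count_list (take t x) b + count_list (drop t x) b = count_list x b" for x
    by (metis append_take_drop_id count_list_append)
  ultimately have "count_list (take t u) b = count_list (take t v) b"
    using k_abelian_equiv_count_eq[OF eq k b] split[of u] split[of v] by linarith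
  then show ?thesis by (simp add: prefix_count_def)
qed

section \<open>Counting classes through an invariant\<close>

lemma card_image_le_card_quotient:
  assumes fin: "finite F" and refl: "\<And>u. u \<in> F \<Longrightarrow> (u, u) \<in> R"
    and inv: "\<And>u v. u \<in> F \<Longrightarrow> v \<in> F \<Longrightarrow> (u, v) \<in> R \<Longrightarrow> g u = g v"
  shows "card (g ` F) \<le> card (F // Restr R F)"
proof (rule surj_card_le)
  show "finite (F // Restr R F)" unfolding quotient_def using fin by simp
  \<comment> \<open>\<open>g\<close> is constant on each class, so its values at chosen
    representatives exhaust the image.\<close>
  show "g ` F \<subseteq> (\<lambda>X. g (SOME x. x \<in> X)) ` (F // Restr R F)"
  proof clarify
    fix u assume u: "u \<in> F"
    let ?X = "Restr R F `` {u}"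
    have "u \<in> ?X" using u refl by blast
    then have "(SOME x. x \<in> ?X) \<in> ?X" by (rule someI)
    then have "g u = g (SOME x. x \<in> ?X)" using inv by blast
    moreover have "?X \<in> F // Restr R F" using u by (rule quotientI)
    ultimately show "g u \<in> (\<lambda>X. g (SOME x. x \<in> X)) ` (F // Restr R F)" by blast
  qed
qed

lemma card_quotient_eq_card_image:
  assumes fin: "finite F"
    and inv: "\<And>u v. u \<in> F \<Longrightarrow> v \<in> F \<Longrightarrow> (u, v) \<in> R \<longleftrightarrow> g u = g v"
  shows "card (F // Restr R F) = card (g ` F)"
proof (rule antisym)
  have "F // Restr R F = (\<lambda>y. {v \<in> F. y = g v}) ` g ` F"
    using inv by (auto simp: quotient_def image_image)
  then show "card (F // Restr R F) \<le> card (g ` F)" using fin by (simp add: card_image_le)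
  show "card (g ` F) \<le> card (F // Restr R F)"
    using fin inv by (intro card_image_le_card_quotient) auto
qed

section \<open>Classes of factors of balanced words\<close>

context binary_word
begin

text \<open>The number of length-\<open>j\<close> windows whose profile contains \<open>s\<close> is, up to a constant, a
  telescoping sum of prefix counts, in which only boundary positions survive.\<close>

lemma balanced_k_abelian_equivI:
  assumes bal: "\<And>j. balanced_at b w j" and A: "range w \<subseteq> A"
    and u: "u \<in> factors w n" and v: "v \<in> factors w n"
    and eq: "\<And>t. t \<in> boundary_positions k n \<Longrightarrow> prefix_count b u t = prefix_count b v t"
  shows "(u, v) \<in> k_abelian_equiv A k"
proof -
  have "occurrences u x = occurrences v x" if x: "x \<noteq> []" "enat (length x) \<le> k" for x
  proof (cases "length x \<le> n \<and> x \<in> factors w (length x)")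
    case False
    have "occurrences y x = 0" if "y \<in> factors w n" for y
    proof -
      have "{i. i + length x \<le> length y \<and> take (length x) (drop i y) = x} = {}"
        using False slice_in_factors[OF that, of _ "length x"] length_factor[OF that] by fastforce
      then show ?thesis unfolding occurrences_def by (simp only: card.empty)
    qed
    then show ?thesis using u v by simp
  next
    case True
    define j where "j = length x"
    define K where "K = {..n - j}"
    define f where "f y i = profile b j (factors w j) (take j (drop i y))" for y i
    have j: "j \<le> n" "1 \<le> j" "enat j \<le> k" and xj: "x \<in> factors w j"
      using True x by (auto simp: j_def Suc_le_eq)
    have K: "finite K" by (simp add: K_def)
    have al: "aligned_balanced b j (factors w j)" by (rule aligned_balanced_factors[OF bal])
    have inj: "inj_on (profile b j (factors w j)) (factors w j)"
      by (rule inj_on_profile[OF al binary_factor])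
    have slice: "take j (drop i y) \<in> factors w j" if "y \<in> factors w n" "i \<in> K" for y i
      using slice_in_factors[OF that(1), of i j] that(2) j by (simp add: K_def)
    \<comment> \<open>Profiles are injective on the factors of length \<open>j\<close>, so counting
      occurrences of \<open>x\<close> is counting windows with the profile of
      \<open>x\<close>.\<close>
    have occ: "occurrences y x = card {i \<in> K. f y i = profile b j (factors w j) x}"
      if y: "y \<in> factors w n" for y
    proof -
      have "{i. i + length x \<le> length y \<and> take (length x) (drop i y) = x} =
          {i \<in> K. take j (drop i y) = x}"
        using length_factor[OF y] j by (auto simp: K_def j_def)
      also have "\<dots> = {i \<in> K. f y i = profile b j (factors w j) x}"
        using inj_on_eq_iff[OF inj slice[OF y] xj] by (auto simp: f_def)
      finally show ?thesis by (simp add: occurrences_def)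
    qed
    define D where "D t = prefix_count b u t - prefix_count b v t" for t
    \<comment> \<open>Since \<open>j \<le> k\<close>, positions at distance less than
      \<open>j\<close> from an end are boundary positions, apart from 0, where both counts
      vanish.\<close>
    have D: "D t = 0" if "t \<le> n" "t < j \<or> n < t + j" for t
    proof (cases "t = 0")
      case False
      have "enat t < k \<or> enat (n - t) < k"
      proof -
        have "t < j \<or> n - t < j" using that by linarith
        then show ?thesis using j(3) by (meson enat_ord_simps(2) less_le_trans)
      qed
      then show ?thesis using that False eq[of t] by (simp add: D_def boundary_positions_def)
    qed (simp add: D_def)
    have "card {i \<in> K. s \<in> f u i} = card {i \<in> K. s \<in> f v i}" for s
    proof (cases "s \<in> {1..j}")
      case False
      then have "{i \<in> K. s \<in> f y i} = {}" for y
        by (auto simp: f_def profile_def)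
      then show ?thesis by (simp only:)
    next
      case s: True
      have card_eq: "int (card {i \<in> K. s \<in> f y i}) = (\<Sum>i\<in>K. of_bool (s \<in> f y i))" for y
      proof -
        have "{i \<in> K. s \<in> f y i} = K \<inter> {i. s \<in> f y i}" by blast
        then show ?thesis using K by (simp only: sum_of_bool_eq)
      qed
      have diff: "of_bool (s \<in> f u i) - of_bool (s \<in> f v i) = D (i + s) - D i" if "i \<in> K" for i
        using prefix_count_diff_profile[OF al slice[OF u that] slice[OF v that], of s] s
        by (simp add: f_def prefix_count_slice D_def)
      have "int (card {i \<in> K. s \<in> f u i}) - int (card {i \<in> K. s \<in> f v i}) =
          (\<Sum>i\<in>K. D (i + s) - D i)"
        unfolding card_eq sum_subtractf[symmetric] by (rule sum.cong) (use diff in auto)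
      also have "\<dots> = (\<Sum>i\<in>K. D (i + s)) - (\<Sum>i\<in>K. D i)" by (rule sum_subtractf)
      \<comment> \<open>Both sums, over \<open>K\<close> and over \<open>K\<close> shifted by
        \<open>s\<close>, omit only positions at distance less than \<open>j\<close> from an end,
        where \<open>D\<close> is 0. Each therefore equals the sum over all of \<open>{..n}\<close>,
        and they cancel.\<close>
      also have "(\<Sum>i\<in>K. D i) = (\<Sum>t\<le>n. D t)"
      proof (rule sum.mono_neutral_left)
        show "\<forall>t\<in>{..n} - K. D t = 0" unfolding K_def by (intro ballI D) auto
      qed (auto simp: K_def)
      also have "(\<Sum>i\<in>K. D (i + s)) = (\<Sum>t\<in>(\<lambda>i. i + s) ` K. D t)"
        by (simp add: sum.reindex o_def)
      also have "\<dots> = (\<Sum>t\<le>n. D t)"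
      proof (rule sum.mono_neutral_left)
        show "(\<lambda>i. i + s) ` K \<subseteq> {..n}" using s j by (auto simp: K_def)
        show "\<forall>t\<in>{..n} - (\<lambda>i. i + s) ` K. D t = 0"
        proof
          fix t assume t: "t \<in> {..n} - (\<lambda>i. i + s) ` K"
          have "t - s \<notin> K" if "s \<le> t"
            using t that image_eqI[of t "\<lambda>i. i + s" "t - s" K] by auto
          then have "t < s \<or> n - j < t - s" unfolding K_def by (metis atMost_iff not_le)
          then show "D t = 0" using t s by (intro D) auto
        qed
      qed simp
      finally show ?thesis by simp
    qed
    \<comment> \<open>Agreement for every single point \<open>s\<close> determines how often each
      member of the chain of profiles occurs.\<close>
    then have "card {i \<in> K. f u i = profile b j (factors w j) x} =
        card {i \<in> K. f v i = profile b j (factors w j) x}"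
      using finite_factors[OF finite_range] slice u v xj
      by (intro chain_multiplicity_determined[OF chain_profiles[OF al] _ K]) (auto simp: f_def)
    then show ?thesis using occ[OF u] occ[OF v] by simp
  qed
  moreover have "u \<in> lists A" "v \<in> lists A"
    using set_factor[OF u] set_factor[OF v] A by (auto simp: in_lists_conv_set)
  ultimately show ?thesis unfolding k_abelian_equiv_def by blast
qed

definition boundary_counts :: "enat \<Rightarrow> nat \<Rightarrow> 'a list \<Rightarrow> (nat \<times> int) set" where
  "boundary_counts k n u = (\<lambda>t. (t, prefix_count b u t)) ` boundary_positions k n"

lemma k_abelian_equiv_boundary_counts:
  assumes "finite A" "range w \<subseteq> A" "1 \<le> k" "(u, v) \<in> k_abelian_equiv A k"
    and "u \<in> factors w n" "v \<in> factors w n"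
  shows "boundary_counts k n u = boundary_counts k n v"
  unfolding boundary_counts_def graph_eq_iff
proof
  fix t assume t: "t \<in> boundary_positions k n"
  have "b \<in> A" using assms(2) range_eq by auto
  from k_abelian_equiv_prefix_count_eq[OF assms(1,4,3) this _ _ t]
  show "prefix_count b u t = prefix_count b v t" using length_factor assms(5,6) by blast
qed

lemma card_boundary_counts:
  assumes "aligned_balanced b n U" "U \<subseteq> factors w n" "card U = n + 1" "1 \<le> k"
  shows "card (boundary_counts k n ` U) = sturmian_complexity k n"
  unfolding boundary_counts_def card_boundary_positions[OF assms(4), symmetric]
  by (rule aligned_balanced_card_restrict[OF assms(1) _ assms(3) boundary_positions_subset])
    (use assms(2) binary_factor in blast)

text \<open>By balance the boundary counts are a complete invariant of the classes, and the
  \<open>n + 1\<close> factors give a maximal chain whose restriction can be counted.\<close>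

lemma k_abelian_complexity_if_sturmian:
  assumes "finite A" "range w \<subseteq> A" "1 \<le> k" "aperiodic w" "\<And>n. card (factors w n) = n + 1"
  shows "k_abelian_complexity A k w n = sturmian_complexity k n"
proof -
  have bal: "balanced_at b w j" for j by (rule balanced_if_sturmian[OF assms(4,5)])
  have "(u, v) \<in> k_abelian_equiv A k \<longleftrightarrow> boundary_counts k n u = boundary_counts k n v"
    if "u \<in> factors w n" "v \<in> factors w n" for u v
    using k_abelian_equiv_boundary_counts[OF assms(1-3) _ that]
      balanced_k_abelian_equivI[OF bal assms(2) that]
    unfolding boundary_counts_def graph_eq_iff by blast
  then have "k_abelian_complexity A k w n = card (boundary_counts k n ` factors w n)"
    unfolding k_abelian_complexity_def
    by (rule card_quotient_eq_card_image[OF finite_factors[OF finite_range]])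
  also have "\<dots> = sturmian_complexity k n"
    by (rule card_boundary_counts) (use aligned_balanced_factors[OF bal] assms in auto)
  finally show ?thesis .
qed

text \<open>Without balance the boundary counts are still an invariant of the classes, which gives a
  lower bound.\<close>

lemma k_abelian_complexity_ge:
  assumes "finite A" "range w \<subseteq> A" "1 \<le> k"
  shows "card (boundary_counts k n ` factors w n) \<le> k_abelian_complexity A k w n"
  unfolding k_abelian_complexity_def
proof (rule card_image_le_card_quotient[OF finite_factors[OF finite_range]])
  fix u assume "u \<in> factors w n"
  then have "u \<in> lists A" using subset_trans[OF set_factor assms(2)] by (simp add: lists_eq_set)
  then show "(u, u) \<in> k_abelian_equiv A k" by (simp add: k_abelian_equiv_def)
qed (rule k_abelian_equiv_boundary_counts[OF assms])

lemma balanced_if_k_abelian_complexity: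
  assumes A: "finite A" "range w \<subseteq> A" and k: "1 \<le> k" and aper: "aperiodic w"
    and compl: "\<And>n. k_abelian_complexity A k w n = sturmian_complexity k n"
  shows "balanced_at b w n"
proof (rule ccontr)
  assume unbal: "\<not> balanced_at b w n"
  show False
  proof (rule unbalanced_minimal[OF unbal])
    fix m B assume min: "\<And>j. j < m \<Longrightarrow> balanced_at b w j"
      and aBa: "a # B @ [a] \<in> factors w m" and bBb: "b # B @ [b] \<in> factors w m"
    let ?x = "a # B @ [a]" and ?y = "b # B @ [b]"
    define U where "U = factors w m - {?x}"
    then have U_subset: "U \<subseteq> factors w m" by blast
    have fin: "finite (factors w m)" by (rule finite_factors[OF finite_range])
    have m: "m = Suc (Suc (length B))" using binary_factor[OF aBa] by simp
    have inner: "prefix_count b (c # B @ [c]) m = 2 * of_bool (c = b) + prefix_count b B (length B)" for c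
      by (simp add: m prefix_count_Cons prefix_count_snoc_length)
    have gap: "prefix_count b ?y m = prefix_count b ?x m + 2" using inner[of a] inner[of b] neq by simp
    \<comment> \<open>A gap of two forces \<open>u = ?x\<close>. If \<open>?x\<close> has no more
      letters \<open>b\<close> than \<open>u\<close>, then \<open>v\<close> has this gap to both
      \<open>u\<close> and \<open>?x\<close>, and the form of such pairs identifies them. Otherwise
      \<open>u\<close> has the gap to \<open>?y\<close>, whose inner part is
      \<open>B\<close>.\<close>
    have total: "prefix_count b v m - prefix_count b u m \<le> 1" if uv: "u \<in> U" "v \<in> factors w m" for u v
    proof (rule ccontr)
      assume "\<not> ?thesis"
      then have big: "prefix_count b u m + 2 \<le> prefix_count b v m" by simp
      have "u = ?x"
      proof (cases "prefix_count b ?x m \<le> prefix_count b u m")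
        case True
        then have "prefix_count b ?x m + 2 \<le> prefix_count b v m" using big by simp
        with minimal_unbalanced_form[OF min aBa uv(2)] minimal_unbalanced_form[OF min _ uv(2) big] uv(1)
        show ?thesis unfolding U_def by (metis DiffD1 append1_eq_conv list.inject)
      next
        case False
        then have "prefix_count b u m + 2 \<le> prefix_count b ?y m" using gap by simp
        with minimal_unbalanced_form[OF min _ bBb, of u] uv(1)
        show ?thesis unfolding U_def by (metis DiffD1 append1_eq_conv list.inject)
      qed
      then show False using uv(1) by (simp add: U_def)
    qed
    have "aligned_balanced b m U"
      unfolding aligned_balanced_def
    proof (intro ballI allI impI)
      fix u v s t assume uv: "u \<in> U" "v \<in> U" and st: "s \<le> t" "t \<le> m"
      then have uv': "u \<in> factors w m" "v \<in> factors w m" by (auto simp: U_def)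
      show "(prefix_count b v t - prefix_count b v s) - (prefix_count b u t - prefix_count b u s) \<le> 1"
      \<comment> \<open>Shorter windows are balanced by minimality of \<open>m\<close>; only the
        full words need the removal of \<open>?x\<close>.\<close>
      proof (cases "t - s < m")
        case True
        then show ?thesis using balanced_at_slice_le[OF min[OF True] uv', of s s] st by simp
      next
        case False
        then have "s = 0" "t = m" using st m by auto
        then show ?thesis using total[OF uv(1) uv'(2)] by simp
      qed
    qed
    moreover have "card U = m + 1"
    proof (rule antisym)
      show "card U \<le> m + 1"
        by (rule aligned_balanced_card_le[OF calculation binary_factor]) (simp add: U_def)
      show "m + 1 \<le> card U"
        using minimal_unbalanced_card_ge[OF aper min aBa bBb] fin aBa
        by (simp add: U_def card_Diff_singleton)
    qed
    ultimately have card_U: "card (boundary_counts k m ` U) = sturmian_complexity k m"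
      using k by (intro card_boundary_counts) (auto simp: U_def)
    \<comment> \<open>The total count at position \<open>m\<close> is visible to the equivalence. It
      is strictly larger for every member of \<open>U\<close> than for \<open>?x\<close>, because
      each is within one of \<open>?y\<close>; so \<open>?x\<close> adds a further class.\<close>
    have "enat 0 < k" using k by (metis enat_0 zero_less_one less_le_trans)
    then have "m \<in> boundary_positions k m" using m by (simp add: boundary_positions_def)
    moreover have "prefix_count b u m \<noteq> prefix_count b ?x m" if "u \<in> U" for u
      using total[OF that bBb] gap by simp
    ultimately have "boundary_counts k m ?x \<notin> boundary_counts k m ` U"
      unfolding boundary_counts_def image_iff graph_eq_iff by metis
    then have "card (boundary_counts k m ` insert ?x U) = sturmian_complexity k m + 1"
      using card_U finite_subset[of U, OF _ fin] by (simp add: U_subset)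
    moreover have "insert ?x U = factors w m" using aBa by (auto simp: U_def)
    ultimately show False using k_abelian_complexity_ge[OF A k, of m] compl[of m] by simp
  qed
qed

end

text \<open>Distinct letters are never equivalent, so the complexity at length 1 reveals the number
  of letters that occur. This shows that the word is binary before balance can be discussed.\<close>

lemma card_range_eq_k_abelian_complexity_1:
  assumes "finite (range w)" "range w \<subseteq> A" "1 \<le> k"
  shows "k_abelian_complexity A k w 1 = card (range w)"
proof -
  have F: "factors w 1 = (\<lambda>c. [c]) ` range w"
    by (auto simp: factors_def)
  have "(u, v) \<in> k_abelian_equiv A k \<longleftrightarrow> id u = id v" if uv: "u \<in> factors w 1" "v \<in> factors w 1" for u v
  proof
    assume eq: "(u, v) \<in> k_abelian_equiv A k"
    obtain c d where cd: "u = [c]" "v = [d]" "c \<in> A" using uv assms(2) unfolding F by auto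
    show "id u = id v" using k_abelian_equiv_count_eq[OF eq assms(3) cd(3)] cd by (simp split: if_splits)
  next
    assume "id u = id v"
    then show "(u, v) \<in> k_abelian_equiv A k"
      using uv set_factor[OF uv(1)] assms(2) by (auto simp: k_abelian_equiv_def in_lists_conv_set)
  qed
  then have "k_abelian_complexity A k w 1 = card (id ` factors w 1)"
    unfolding k_abelian_complexity_def
    by (rule card_quotient_eq_card_image[OF finite_factors[OF assms(1)]])
  also have "\<dots> = card (range w)"
    unfolding F by (simp add: card_image inj_on_def)
  finally show ?thesis .
qed

theorem theorem21:
  fixes A :: "'a set" and k :: enat and \<omega> :: "'a word"
  assumes "k \<ge> 1"
    and "finite A" and "A \<noteq> {}"
    and "range \<omega> \<subseteq> A"
    and "aperiodic \<omega>"
  shows "sturmian \<omega> \<longleftrightarrow>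
    (\<forall>n. k_abelian_complexity A k \<omega> n = sturmian_complexity k n)"
proof
  assume st: "sturmian \<omega>"
  then obtain a b where "range \<omega> = {a, b}" "a \<noteq> b"
    unfolding sturmian_def card_2_iff by blast
  then interpret binary_word \<omega> a b by unfold_locales
  show "\<forall>n. k_abelian_complexity A k \<omega> n = sturmian_complexity k n"
    using k_abelian_complexity_if_sturmian[OF assms(2,4,1,5)] st unfolding sturmian_def by blast
next
  assume compl: "\<forall>n. k_abelian_complexity A k \<omega> n = sturmian_complexity k n"
  have fin: "finite (range \<omega>)" using assms(2,4) by (rule rev_finite_subset)
  have "sturmian_complexity k 1 = 2"
    using assms(1) by (cases k) (auto simp: sturmian_complexity_def one_enat_def)
  then have card2: "card (range \<omega>) = 2"
    using compl card_range_eq_k_abelian_complexity_1[OF fin assms(4,1)] by simp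
  then obtain a b where "range \<omega> = {a, b}" "a \<noteq> b"
    unfolding card_2_iff by blast
  then interpret binary_word \<omega> a b by unfold_locales
  \<comment> \<open>Balance bounds the number of factors from above by the length of a chain,
    aperiodicity from below.\<close>
  have "card (factors \<omega> n) = n + 1" for n
    using balanced_card_le[OF balanced_if_k_abelian_complexity[OF assms(2,4,1,5)]] compl
      aperiodic_card_factors_ge[OF fin assms(5)] by (simp add: order_antisym)
  then show "sturmian \<omega>" using card2 unfolding sturmian_def by simp
qed

end
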